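(* Let $p$ be a prime, let $k,\ell,n,d,r$ be positive integers, and let $\Psi=\{\psi_1,\ldots,\psi_r\}$ be a system of $r$ linear forms in $d$ variables over $\mathbb{F}_p$. Let $i\in[r]$ and suppose that $\Psi$ has sequential CS-complexity at most $(k,\ell)$ at $i$. Then for every collection of $1$-bounded functions $f_1,\ldots,f_r:\mathbb{F}_p^n\to\mathbb{C}$ we have \[ \big|\Lambda_\Psi(f_1,\ldots,f_r)\big|\le \|f_i\|_{U^{k+1}}^{2^{1-\ell}}. \]
   Context: A linear form in $d$ variables over $\mathbb{F}_p$ is identified with a vector $\psi=(\psi_{1},\ldots,\psi_{d})\in\mathbb{F}_p^d$; it acts on $(\mathbb{F}_p^n)^d$ by $\psi(x_1,\ldots,x_d)=\psi_{1}x_1+\cdots+\psi_{d}x_d$. For $S\subset\mathbb{F}_p^d$, $\langle S\rangle$ is its $\mathbb{F}_p$-linear span. The $\Psi$-average is $\Lambda_\Psi(f_1,\ldots,f_r)=\mathbb{E}_{x_1,\ldots,x_d\in\mathbb{F}_p^n}\prod_{j=1}^r f_j(\psi_j(x_1,\ldots,x_d))$. A function is $1$-bounded if its modulus is at most $1$ everywhere. For $s\ge1$ the Gowers norm is $\|f\|_{U^s}^{2^s}=\mathbb{E}_{x,h_1,\ldots,h_s\in\mathbb{F}_p^n}\prod_{\omega\in\{0,1\}^s}\mathcal{C}^{|\omega|}f(x+\omega_1h_1+\cdots+\omega_sh_s)$, where $\mathcal{C}$ is complex conjugation and $|\omega|=\omega_1+\cdots+\omega_s$. Sequential CS-complexity: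 $\Psi$ has sequential CS-complexity at most $(k,\ell)$ at $i\in[r]$ if there is a sequence $\psi^{(1)},\ldots,\psi^{(\ell)}$ of elements of $\Psi$ with $\psi^{(\ell)}=\psi_i$ such that for every $j\in[\ell]$ there exist sets $C_{j,1},\ldots,C_{j,k+1}\subset\Psi$ with $\Psi\setminus\{\psi^{(1)},\ldots,\psi^{(j)}\}\subset\bigcup_{t=1}^{k+1}C_{j,t}$ and $\{\psi^{(1)},\ldots,\psi^{(j)}\}\cap\langle C_{j,t}\rangle=\emptyset$ for every $t\in[k+1]$. *)

theory Defs
  imports "HOL-Analysis.Analysis" "Berlekamp_Zassenhaus.Finite_Field"
begin

text \<open>
  The field with p elements is \<open>'p mod_ring\<close> with \<open>'p :: prime_card\<close>, so that \<open>p = CARD('p)\<close> is an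
  arbitrary prime; \<open>n = CARD('n)\<close> and \<open>d = CARD('d)\<close>.  A linear form in \<open>d\<close> variables is
  identified with its coefficient vector.
\<close>

definition form_apply :: "'a::field ^ 'd \<Rightarrow> ('a ^ 'n) ^ 'd \<Rightarrow> 'a ^ 'n" where
  "form_apply \<phi> x = (\<Sum>m\<in>UNIV. (\<phi> $ m) *s (x $ m))"

definition average :: "'b set \<Rightarrow> ('b \<Rightarrow> complex) \<Rightarrow> complex" where
  "average A g = (\<Sum>x\<in>A. g x) / of_nat (card A)"

definition form_average ::
  "nat \<Rightarrow> (nat \<Rightarrow> 'a::{field,finite} ^ 'd) \<Rightarrow> (nat \<Rightarrow> 'a ^ 'n \<Rightarrow> complex) \<Rightarrow> complex" where
  "form_average r \<psi> f = average UNIV (\<lambda>x. \<Prod>j=1..r. f j (form_apply (\<psi> j) x))"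

definition one_bounded :: "('b \<Rightarrow> complex) \<Rightarrow> bool" where
  "one_bounded f \<longleftrightarrow> (\<forall>x. cmod (f x) \<le> 1)"

text \<open>
  A tuple \<open>(h\<^sub>1, \<dots>, h\<^sub>s)\<close> is an extensional function on \<open>{1..s}\<close>, and \<open>\<omega> \<in> {0,1}\<^sup>s\<close> is encoded as
  the set of those \<open>m \<in> {1..s}\<close> with \<open>\<omega>\<^sub>m = 1\<close>.
\<close>

definition gowers_average :: "nat \<Rightarrow> ('a::{field,finite} ^ 'n \<Rightarrow> complex) \<Rightarrow> complex" where
  "gowers_average s f = average (UNIV \<times> ({1..s} \<rightarrow>\<^sub>E UNIV))
     (\<lambda>(x, h). \<Prod>\<omega>\<in>Pow {1..s}. (cnj ^^ card \<omega>) (f (x + (\<Sum>m\<in>\<omega>. h m))))"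

text \<open>
  For \<open>s \<ge> 1\<close> the average is a nonnegative real number, so that taking its real part loses
  nothing and the \<open>2\<^sup>s\<close>-th power of the norm is the average itself.
\<close>

definition gowers_norm :: "nat \<Rightarrow> ('a::{field,finite} ^ 'n \<Rightarrow> complex) \<Rightarrow> real" where
  "gowers_norm s f = root (2 ^ s) (Re (gowers_average s f))"

definition seq_CS_complexity_at_most ::
  "('a::field ^ 'd) set \<Rightarrow> 'a ^ 'd \<Rightarrow> nat \<Rightarrow> nat \<Rightarrow> bool" where
  "seq_CS_complexity_at_most \<Psi> \<phi> k l \<longleftrightarrow>
     (\<exists>\<sigma> :: nat \<Rightarrow> 'a ^ 'd.
        \<sigma> ` {1..l} \<subseteq> \<Psi> \<and> \<sigma> l = \<phi> \<and>
        (\<forall>j\<in>{1..l}. \<exists>C :: nat \<Rightarrow> ('a ^ 'd) set.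
           (\<forall>t\<in>{1..k+1}. C t \<subseteq> \<Psi>) \<and>
           \<Psi> - \<sigma> ` {1..j} \<subseteq> (\<Union>t\<in>{1..k+1}. C t) \<and>
           (\<forall>t\<in>{1..k+1}. \<sigma> ` {1..j} \<inter> vec.span (C t) = {})))"

end

theory Submission
  imports Defs
begin

text \<open>
  Write the \<open>\<Psi>\<close>-average as the correlation of the function attached to the form \<open>\<phi> = \<sigma> 1\<close> with
  its dual function, the average of the other factors over the fibres of \<open>\<phi>\<close>.  By
  Cauchy--Schwarz, squaring the average allows one to replace the function at \<open>\<phi>\<close> by the conjugate
  of this dual function; doing so along \<open>\<sigma> 1, \<sigma> 2, \<dots>\<close> costs one squaring per step.  The gain is
  that dual functions are structured: evaluated at \<open>h\<^sub>1 + \<dots> + h\<^sub>s\<close>, where \<open>s = k + 1\<close>, each is an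
  average of products of 1-bounded factors, the \<open>t\<close>-th of which does not depend on \<open>h\<^sub>t\<close>.  For the
  forms in \<open>C\<^sub>j\<^sub>,\<^sub>t\<close> this comes from a direction that \<open>\<sigma> j\<close> sees and \<open>C\<^sub>j\<^sub>,\<^sub>t\<close> does not; the functions
  at the earlier forms \<open>\<sigma> 1, \<dots>, \<sigma> (j - 1)\<close> are structured already, and structure survives affine
  substitutions and products.  Finally, \<open>s\<close> applications of Cauchy--Schwarz bound the correlation of
  any function with a structured one by its Gowers norm.
\<close>

section \<open>Averages over finite sets\<close>

lemma average_cong:
  assumes "\<And>x. x \<in> A \<Longrightarrow> g x = h x"
  shows "average A g = average A h"
  using assms by (simp add: average_def)

lemma average_const [simp]:
  assumes "finite A" "A \<noteq> {}"
  shows "average A (\<lambda>x. c) = c"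
  using assms by (simp add: average_def)

lemma average_mult_left: "average A (\<lambda>x. c * g x) = c * average A g"
  by (simp add: average_def sum_distrib_left)

lemma average_mult_right: "average A (\<lambda>x. g x * c) = average A g * c"
  by (simp add: average_def sum_distrib_right)

lemma cnj_average: "cnj (average A g) = average A (\<lambda>x. cnj (g x))"
  by (simp add: average_def)

lemma average_swap:
  "average A (\<lambda>x. average B (\<lambda>y. g x y)) = average B (\<lambda>y. average A (\<lambda>x. g x y))"
  by (simp add: average_def sum_divide_distrib [symmetric] sum.swap [of _ A] mult.commute)

lemma average_Times:
  "average (A \<times> B) (\<lambda>(x, y). g x y) = average A (\<lambda>x. average B (g x))"
  by (simp add: average_def sum.cartesian_product [symmetric] sum_divide_distrib [symmetric]
      card_cartesian_product mult.commute)

lemma average_reindex: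
  assumes "bij_betw \<pi> A B"
  shows "average A (\<lambda>x. g (\<pi> x)) = average B g"
  using sum.reindex_bij_betw [OF assms, of g] bij_betw_same_card [OF assms]
  by (simp add: average_def)

lemma average_translate:
  fixes g :: "'b::group_add \<Rightarrow> complex"
  shows "average UNIV (\<lambda>x. g (x + a)) = average UNIV g"
  by (rule average_reindex, rule bij_betw_byWitness [of _ "\<lambda>x. x - a"]) auto

lemma average_translate_left:
  fixes g :: "'b::ab_group_add \<Rightarrow> complex"
  shows "average UNIV (\<lambda>x. g (a + x)) = average UNIV g"
  using average_translate [of g a] by (simp add: add.commute)

lemma average_PiE_insert:
  fixes G :: "('i \<Rightarrow> 'b::finite) \<Rightarrow> complex"
  assumes "finite S" "i \<notin> S"
  shows "average (insert i S \<rightarrow>\<^sub>E UNIV) G =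
    average (S \<rightarrow>\<^sub>E UNIV) (\<lambda>h. average UNIV (\<lambda>z. G (h(i := z))))"
proof -
  have "bij_betw (\<lambda>(z, h). h(i := z)) (UNIV \<times> (S \<rightarrow>\<^sub>E (UNIV :: 'b set))) (insert i S \<rightarrow>\<^sub>E UNIV)"
    using inj_combinator [OF assms(2), of "\<lambda>_. UNIV :: 'b set"]
      PiE_insert_eq [of i S "\<lambda>_. UNIV :: 'b set"]
    by (simp add: bij_betw_def)
  from average_reindex [OF this, of G]
  have "average (insert i S \<rightarrow>\<^sub>E UNIV) G =
      average (UNIV \<times> (S \<rightarrow>\<^sub>E UNIV)) (\<lambda>(z, h). G (h(i := z)))"
    by (simp add: case_prod_unfold)
  then show ?thesis
    by (simp add: average_Times average_swap [of UNIV])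
qed

lemma cmod_average_le:
  assumes "\<And>x. x \<in> A \<Longrightarrow> cmod (g x) \<le> M" "M \<ge> 0"
  shows "cmod (average A g) \<le> M"
proof (cases "card A = 0")
  case False
  have "cmod (sum g A) \<le> of_nat (card A) * M"
    using assms(1) by (rule sum_norm_bound)
  then show ?thesis
    using False by (simp add: average_def norm_divide field_simps)
qed (use assms in \<open>simp add: average_def\<close>)

lemma convex_on_nonneg_power: "convex_on {0::real..} (\<lambda>x. x ^ n)"
  using convex_power_odd [of n] convex_on_subset [OF convex_power_even [of n]]
  by (cases "even n") auto

text \<open>The triangle inequality, then Jensen for the convex function \<open>x ^ n\<close> on the
  nonnegative reals. The pointwise bounds are real parts because they come from Gowers averages or
  from \<open>cnj (b x) * b x\<close>.\<close>

lemma cmod_average_power_le: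
  assumes "finite A" "A \<noteq> {}" and le: "\<And>x. x \<in> A \<Longrightarrow> cmod (g x) ^ n \<le> Re (G x)"
  shows "cmod (average A g) ^ n \<le> Re (average A G)"
proof -
  let ?c = "1 / real (card A)"
  have card: "card A > 0"
    using assms by (simp add: card_gt_0_iff)
  have "cmod (average A g) \<le> (\<Sum>x\<in>A. ?c *\<^sub>R cmod (g x))"
    using norm_sum [of g A]
    by (simp add: average_def norm_divide sum_divide_distrib [symmetric] divide_right_mono)
  then have "cmod (average A g) ^ n \<le> (\<Sum>x\<in>A. ?c *\<^sub>R cmod (g x)) ^ n"
    by (intro power_mono) auto
  also have "\<dots> \<le> (\<Sum>x\<in>A. ?c * cmod (g x) ^ n)"
    using assms card
    by (intro convex_on_sum [OF _ _ convex_on_nonneg_power]) auto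
  also have "\<dots> \<le> (\<Sum>x\<in>A. ?c * Re (G x))"
    using le by (intro sum_mono mult_left_mono) auto
  also have "\<dots> = Re (average A G)"
    by (simp add: average_def sum_divide_distrib)
  finally show ?thesis .
qed

lemma average_cauchy_schwarz:
  assumes "finite A" "A \<noteq> {}" and a: "\<And>x. x \<in> A \<Longrightarrow> cmod (a x) \<le> 1"
  shows "cmod (average A (\<lambda>x. a x * b x)) ^ 2 \<le> Re (average A (\<lambda>x. cnj (b x) * b x))"
proof (rule cmod_average_power_le [OF assms(1,2)])
  fix x assume "x \<in> A"
  have "cmod (a x * b x) ^ 2 \<le> cmod (b x) ^ 2"
    using mult_left_le_one_le [OF norm_ge_zero norm_ge_zero a [OF \<open>x \<in> A\<close>]]
    by (intro power_mono) (auto simp: norm_mult)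
  also have "\<dots> = Re (cnj (b x) * b x)"
    by (simp add: cmod_power2 flip: power2_eq_square)
  finally show "cmod (a x * b x) ^ 2 \<le> Re (cnj (b x) * b x)" .
qed

section \<open>Gowers norms and the box Cauchy--Schwarz inequality\<close>

text \<open>The conjugate sits on the shifted value, matching the Gowers cube, where each further
  shift brings one more conjugation.\<close>

definition mult_deriv :: "'b::ab_group_add \<Rightarrow> ('b \<Rightarrow> complex) \<Rightarrow> 'b \<Rightarrow> complex" where
  "mult_deriv z f x = f x * cnj (f (x + z))"

lemma funpow_cnj_mult: "(cnj ^^ n) (a * b) = (cnj ^^ n) a * (cnj ^^ n) b"
  by (induction n) auto

lemma cmod_funpow_cnj [simp]: "cmod ((cnj ^^ n) a) = cmod a"
  by (induction n) auto

lemma gowers_average_0: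
  fixes f :: "'a::{field,finite} ^ 'n \<Rightarrow> complex"
  shows "gowers_average 0 f = average UNIV f"
proof -
  have "gowers_average 0 f = average (UNIV \<times> {\<lambda>x :: nat. undefined :: 'a ^ 'n}) (\<lambda>(x, h). f x)"
    by (simp add: gowers_average_def case_prod_unfold)
  then show ?thesis
    by (simp only: average_Times) simp
qed

text \<open>The cube is split along its last coordinate: the vertices \<open>\<omega>\<close> and
  \<open>insert (Suc s) \<omega>\<close> combine to one factor of the derivative in direction
  \<open>z\<close>, the last entry of the tuple.\<close>

lemma gowers_average_Suc:
  fixes f :: "'a::{field,finite} ^ 'n \<Rightarrow> complex"
  shows "gowers_average (Suc s) f = average UNIV (\<lambda>z. gowers_average s (mult_deriv z f))"
proof -
  let ?I = "{1..s} :: nat set"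
  have ins: "{1..Suc s} = insert (Suc s) ?I"
    by auto
  have cube: "(\<Prod>\<omega>\<in>Pow {1..Suc s}. (cnj ^^ card \<omega>) (f (x + (\<Sum>m\<in>\<omega>. (h(Suc s := z)) m)))) =
    (\<Prod>\<omega>\<in>Pow ?I. (cnj ^^ card \<omega>) (mult_deriv z f (x + (\<Sum>m\<in>\<omega>. h m))))" for x z h
  proof -
    let ?F = "\<lambda>\<omega>. (cnj ^^ card \<omega>) (f (x + (\<Sum>m\<in>\<omega>. (h(Suc s := z)) m)))"
    have inj: "inj_on (insert (Suc s)) (Pow ?I)"
      by (rule inj_on_inverseI [of _ "\<lambda>\<omega>. \<omega> - {Suc s}"]) auto
    have "(\<Prod>\<omega>\<in>Pow {1..Suc s}. ?F \<omega>) = prod ?F (Pow ?I \<union> insert (Suc s) ` Pow ?I)"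
      by (simp only: ins Pow_insert)
    also have "\<dots> = prod ?F (Pow ?I) * prod ?F (insert (Suc s) ` Pow ?I)"
      by (intro prod.union_disjoint) auto
    also have "\<dots> = (\<Prod>\<omega>\<in>Pow ?I. ?F \<omega> * ?F (insert (Suc s) \<omega>))"
      by (simp only: prod.reindex [OF inj] prod.distrib o_def)
    also have "\<dots> = (\<Prod>\<omega>\<in>Pow ?I. (cnj ^^ card \<omega>) (mult_deriv z f (x + (\<Sum>m\<in>\<omega>. h m))))"
    proof (rule prod.cong [OF refl])
      fix \<omega> assume "\<omega> \<in> Pow ?I"
      then have w: "finite \<omega>" "Suc s \<notin> \<omega>"
        by (auto intro: finite_subset)
      have "(\<Sum>m\<in>\<omega>. (h(Suc s := z)) m) = (\<Sum>m\<in>\<omega>. h m)"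
        using w by (intro sum.cong) auto
      moreover have "(\<Sum>m\<in>insert (Suc s) \<omega>. (h(Suc s := z)) m) = (\<Sum>m\<in>\<omega>. h m) + z"
        using w calculation by (simp add: add.commute)
      ultimately show "?F \<omega> * ?F (insert (Suc s) \<omega>) =
          (cnj ^^ card \<omega>) (mult_deriv z f (x + (\<Sum>m\<in>\<omega>. h m)))"
        using w by (simp add: mult_deriv_def funpow_cnj_mult ac_simps funpow_swap1)
    qed
    finally show ?thesis .
  qed
  have "gowers_average (Suc s) f =
      average UNIV (\<lambda>x. average (?I \<rightarrow>\<^sub>E UNIV) (\<lambda>h. average UNIV (\<lambda>z.
        \<Prod>\<omega>\<in>Pow ?I. (cnj ^^ card \<omega>) (mult_deriv z f (x + (\<Sum>m\<in>\<omega>. h m))))))"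
    unfolding gowers_average_def average_Times ins
    by (subst average_PiE_insert) (simp_all only: ins [symmetric] cube, auto)
  also have "\<dots> = average UNIV (\<lambda>z. gowers_average s (mult_deriv z f))"
    unfolding gowers_average_def average_Times
    by (subst average_swap [of "?I \<rightarrow>\<^sub>E UNIV"], subst average_swap) (rule refl)
  finally show ?thesis .
qed

lemma cmod_gowers_average_le:
  assumes "one_bounded f"
  shows "cmod (gowers_average s f) \<le> 1"
  unfolding gowers_average_def
  using assms
  by (intro cmod_average_le) (auto simp: one_bounded_def prod_norm [symmetric] intro!: prod_le_1)

definition bounded_indep :: "nat \<Rightarrow> ((nat \<Rightarrow> 'v) \<Rightarrow> complex) \<Rightarrow> bool" where
  "bounded_indep t B \<longleftrightarrow> one_bounded B \<and> (\<forall>h z. B (h(t := z)) = B h)"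

text \<open>The factor \<open>B (Suc s)\<close> does not see the last coordinate \<open>z\<close>,
  so it leaves the average over \<open>z\<close> and is discarded by Cauchy--Schwarz in the other
  coordinates. Expanding the remaining square over \<open>z\<close> and \<open>z + w\<close>
  differentiates \<open>f\<close> in direction \<open>w\<close> and leaves one coordinate
  fewer.\<close>

lemma van_der_corput:
  fixes f :: "'a::{field,finite} ^ 'n \<Rightarrow> complex"
  assumes "\<And>t. t \<in> {1..Suc s} \<Longrightarrow> bounded_indep t (B t)"
  obtains B' where "\<And>w z t. t \<in> {1..s} \<Longrightarrow> bounded_indep t (B' w z t)"
    and "cmod (average ({1..Suc s} \<rightarrow>\<^sub>E UNIV)
        (\<lambda>h. f (x + (\<Sum>t\<in>{1..Suc s}. h t)) * (\<Prod>t\<in>{1..Suc s}. B t h))) ^ 2 \<le>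
      Re (average UNIV (\<lambda>w. average UNIV (\<lambda>z. average ({1..s} \<rightarrow>\<^sub>E UNIV)
        (\<lambda>h. mult_deriv w f ((x + z) + (\<Sum>t\<in>{1..s}. h t)) * (\<Prod>t\<in>{1..s}. B' w z t h)))))"
proof
  let ?I = "{1..s} :: nat set"
  define B' where "B' w z t h = B t (h(Suc s := z)) * cnj (B t (h(Suc s := z + w)))" for w z t h
  define b where "b h z = f (x + z + (\<Sum>t\<in>?I. h t)) * (\<Prod>t\<in>?I. B t (h(Suc s := z)))" for h z
  show "bounded_indep t (B' w z t)" if "t \<in> {1..s}" for w z t
  proof -
    have "bounded_indep t (B t)"
      using assms that by simp
    moreover have "(h(t := y))(Suc s := u) = (h(Suc s := u))(t := y)" for h :: "nat \<Rightarrow> 'a ^ 'n" and y u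
      using that by (intro fun_upd_twist) auto
    ultimately show ?thesis
      unfolding bounded_indep_def B'_def one_bounded_def
      by (auto simp: norm_mult intro!: mult_le_one)
  qed
  have ins: "{1..Suc s} = insert (Suc s) ?I"
    by auto
  have last: "bounded_indep (Suc s) (B (Suc s))"
    using assms by simp
  have split: "f (x + (\<Sum>t\<in>{1..Suc s}. (h(Suc s := z)) t)) * (\<Prod>t\<in>{1..Suc s}. B t (h(Suc s := z)))
      = B (Suc s) h * b h z" for h z
  proof -
    have "(\<Sum>t\<in>?I. (h(Suc s := z)) t) = (\<Sum>t\<in>?I. h t)"
      by (intro sum.cong) auto
    then show ?thesis
      using last unfolding ins b_def bounded_indep_def by (simp add: add.assoc)
  qed
  have "cmod (average ({1..Suc s} \<rightarrow>\<^sub>E UNIV)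
        (\<lambda>h. f (x + (\<Sum>t\<in>{1..Suc s}. h t)) * (\<Prod>t\<in>{1..Suc s}. B t h))) ^ 2 =
      cmod (average (?I \<rightarrow>\<^sub>E UNIV) (\<lambda>h. B (Suc s) h * average UNIV (b h))) ^ 2"
    unfolding ins
    by (subst average_PiE_insert) (simp_all only: ins [symmetric] split average_mult_left, auto)
  also have "\<dots> \<le> Re (average (?I \<rightarrow>\<^sub>E UNIV) (\<lambda>h. cnj (average UNIV (b h)) * average UNIV (b h)))"
    using last
    by (intro average_cauchy_schwarz)
      (auto simp: bounded_indep_def one_bounded_def PiE_eq_empty_iff intro: finite_PiE)
  also have "(\<lambda>h. cnj (average UNIV (b h)) * average UNIV (b h)) =
      (\<lambda>h. average UNIV (\<lambda>w. average UNIV (\<lambda>z. b h z * cnj (b h (z + w)))))"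
  proof
    fix h
    have "average UNIV (\<lambda>w. average UNIV (\<lambda>z. b h z * cnj (b h (z + w)))) =
      average UNIV (\<lambda>z. b h z * average UNIV (\<lambda>w. cnj (b h (z + w))))"
      by (subst average_swap) (simp add: average_mult_left)
    also have "\<dots> = average UNIV (\<lambda>z. b h z * cnj (average UNIV (b h)))"
      by (subst average_translate_left) (simp add: cnj_average)
    finally show "cnj (average UNIV (b h)) * average UNIV (b h) =
        average UNIV (\<lambda>w. average UNIV (\<lambda>z. b h z * cnj (b h (z + w))))"
      by (simp add: average_mult_right mult.commute)
  qed
  also have "average (?I \<rightarrow>\<^sub>E UNIV)
        (\<lambda>h. average UNIV (\<lambda>w. average UNIV (\<lambda>z. b h z * cnj (b h (z + w))))) =
      average UNIV (\<lambda>w. average UNIV (\<lambda>z. average (?I \<rightarrow>\<^sub>E UNIV)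
        (\<lambda>h. b h z * cnj (b h (z + w)))))"
    by (simp only: average_swap [of "?I \<rightarrow>\<^sub>E UNIV"])
  also have "(\<lambda>w z h. b h z * cnj (b h (z + w))) =
      (\<lambda>w z h. mult_deriv w f ((x + z) + (\<Sum>t\<in>{1..s}. h t)) * (\<Prod>t\<in>{1..s}. B' w z t h))"
    by (intro ext) (simp add: b_def B'_def mult_deriv_def prod.distrib algebra_simps)
  finally show "cmod (average ({1..Suc s} \<rightarrow>\<^sub>E UNIV)
        (\<lambda>h. f (x + (\<Sum>t\<in>{1..Suc s}. h t)) * (\<Prod>t\<in>{1..Suc s}. B t h))) ^ 2 \<le>
      Re (average UNIV (\<lambda>w. average UNIV (\<lambda>z. average ({1..s} \<rightarrow>\<^sub>E UNIV)
        (\<lambda>h. mult_deriv w f ((x + z) + (\<Sum>t\<in>{1..s}. h t)) * (\<Prod>t\<in>{1..s}. B' w z t h)))))" .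
qed

text \<open>Each induction step is one application of \<open>van_der_corput\<close>, which changes
  \<open>f\<close>, \<open>x\<close> and \<open>B\<close>. Jensen carries the remaining power inside
  the averages over \<open>w\<close> and \<open>z\<close>, and \<open>gowers_average_Suc\<close>
  reassembles the bounds for the derivatives.\<close>

lemma box_cauchy_schwarz:
  fixes f :: "'a::{field,finite} ^ 'n \<Rightarrow> complex"
  assumes "\<And>t. t \<in> {1..Suc s} \<Longrightarrow> bounded_indep t (B t)"
  shows "cmod (average ({1..Suc s} \<rightarrow>\<^sub>E UNIV)
      (\<lambda>h. f (x + (\<Sum>t\<in>{1..Suc s}. h t)) * (\<Prod>t\<in>{1..Suc s}. B t h))) ^ 2 ^ Suc s
    \<le> Re (gowers_average (Suc s) f)"
  using assms
proof (induction s arbitrary: f x B)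
  \<comment> \<open>The induction starts with one coordinate: with none, the claim would read
    \<open>cmod (f x) \<le> Re (average UNIV f)\<close>, which fails in general.\<close>
  case 0
  from van_der_corput [of 0 B, OF "0.prems"] obtain B' where
    "cmod (average ({1..Suc (0::nat)} \<rightarrow>\<^sub>E UNIV)
        (\<lambda>h. f (x + (\<Sum>t\<in>{1..Suc (0::nat)}. h t)) * (\<Prod>t\<in>{1..Suc (0::nat)}. B t h))) ^ 2 \<le>
      Re (average UNIV (\<lambda>w. average UNIV (\<lambda>z. average ({1..0::nat} \<rightarrow>\<^sub>E UNIV)
        (\<lambda>h. mult_deriv w f ((x + z) + (\<Sum>t\<in>{1..0::nat}. h t)) * (\<Prod>t\<in>{1..0::nat}. B' w z t h)))))"
    by blast
  then show ?case
    by (simp add: gowers_average_Suc gowers_average_0 average_translate_left)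
next
  case (Suc s)
  let ?I = "{1..Suc s}"
  from van_der_corput [of "Suc s" B, OF Suc.prems] obtain B' where
    B': "\<And>w z t. t \<in> ?I \<Longrightarrow> bounded_indep t (B' w z t)" and
    le: "cmod (average ({1..Suc (Suc s)} \<rightarrow>\<^sub>E UNIV)
        (\<lambda>h. f (x + (\<Sum>t\<in>{1..Suc (Suc s)}. h t)) * (\<Prod>t\<in>{1..Suc (Suc s)}. B t h))) ^ 2 \<le>
      Re (average UNIV (\<lambda>w. average UNIV (\<lambda>z. average (?I \<rightarrow>\<^sub>E UNIV)
        (\<lambda>h. mult_deriv w f ((x + z) + (\<Sum>t\<in>?I. h t)) * (\<Prod>t\<in>?I. B' w z t h)))))"
    (is "?L ^ 2 \<le> Re ?R")
    by blast
  have "?L ^ 2 ^ Suc (Suc s) = (?L ^ 2) ^ 2 ^ Suc s"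
    by (simp add: power_mult)
  also have "\<dots> \<le> cmod ?R ^ 2 ^ Suc s"
    using le complex_Re_le_cmod [of ?R] by (intro power_mono) auto
  \<comment> \<open>The bound for each derivative is independent of \<open>z\<close>; the constant
    average over \<open>z\<close> keeps the shape of \<open>?R\<close>, so that Jensen applies to
    both averages in turn.\<close>
  also have "\<dots> \<le> Re (average UNIV (\<lambda>w. average UNIV (\<lambda>z :: 'a ^ 'n.
      gowers_average (Suc s) (mult_deriv w f))))"
    using Suc.IH [OF B'] by (intro cmod_average_power_le) auto
  also have "\<dots> = Re (gowers_average (Suc (Suc s)) f)"
    by (simp add: gowers_average_Suc [of "Suc s"])
  finally show ?case .
qed


section \<open>Structured functions\<close>

text \<open>
  The convex hull of the products \<open>B\<^sub>1 \<dots> B\<^sub>s\<close> in which the factor \<open>B\<^sub>t\<close> does not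
  depend on the coordinate \<open>t\<close>.
\<close>
inductive structured :: "nat \<Rightarrow> ((nat \<Rightarrow> 'v) \<Rightarrow> complex) \<Rightarrow> bool" for s where
  product: "(\<And>t. t \<in> {1..s} \<Longrightarrow> bounded_indep t (B t)) \<Longrightarrow> structured s (\<lambda>h. \<Prod>t\<in>{1..s}. B t h)"
| average_nat: "finite (A :: nat set) \<Longrightarrow> A \<noteq> {} \<Longrightarrow> (\<And>i. i \<in> A \<Longrightarrow> structured s (Q i)) \<Longrightarrow>
    structured s (\<lambda>h. average A (\<lambda>i. Q i h))"

text \<open>The inductive rule cannot range over index types and therefore averages over sets of
  naturals; an enumeration of \<open>A\<close> transfers it to any type.\<close>

lemma structured_average:
  assumes "finite A" "A \<noteq> {}" "\<And>i. i \<in> A \<Longrightarrow> structured s (Q i)"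
  shows "structured s (\<lambda>h. average A (\<lambda>i. Q i h))"
proof -
  obtain \<pi> where \<pi>: "bij_betw \<pi> {0..<card A} A"
    using ex_bij_betw_nat_finite [OF assms(1)] by blast
  have "structured s (\<lambda>h. average {0..<card A} (\<lambda>i. Q (\<pi> i) h))"
    using assms bij_betwE [OF \<pi>] by (intro structured.average_nat) (auto simp: card_gt_0_iff)
  moreover have "(\<lambda>h. average {0..<card A} (\<lambda>i. Q (\<pi> i) h)) = (\<lambda>h. average A (\<lambda>i. Q i h))"
    by (rule ext) (rule average_reindex [OF \<pi>])
  ultimately show ?thesis
    by simp
qed

lemma structured_one: "structured s (\<lambda>h. 1)"
  using structured.product [of s "\<lambda>t h. 1"] by (simp add: bounded_indep_def one_bounded_def)

lemma structured_indep:
  assumes "t \<in> {1..s}" "bounded_indep t Q"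
  shows "structured s Q"
proof -
  have "structured s (\<lambda>h. \<Prod>t'\<in>{1..s}. (if t' = t then Q else (\<lambda>h. 1)) h)"
    using assms by (intro structured.product) (auto simp: bounded_indep_def one_bounded_def)
  moreover have "(\<lambda>h. \<Prod>t'\<in>{1..s}. (if t' = t then Q else (\<lambda>h. 1)) h) = Q"
  proof
    show "(\<Prod>t'\<in>{1..s}. (if t' = t then Q else (\<lambda>h. 1)) h) = Q h" for h
      using assms(1) prod.delta [of "{1..s}" t "\<lambda>_. Q h"] by (simp add: if_distribR)
  qed
  ultimately show ?thesis
    by simp
qed

text \<open>Products are multiplied slot by slot, which preserves the independence in each slot;
  averages distribute over multiplication, which takes one induction for each of the two
  functions.\<close>

lemma structured_mult:
  assumes "structured s Q" "structured s R"
  shows "structured s (\<lambda>h. Q h * R h)"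
  using assms(1)
proof induction
  case (product B)
  from assms(2) show ?case
  proof induction
    case (product B')
    have "structured s (\<lambda>h. \<Prod>t\<in>{1..s}. B t h * B' t h)"
      using \<open>\<And>t. t \<in> {1..s} \<Longrightarrow> bounded_indep t (B t)\<close> product
      by (intro structured.product)
        (auto simp: bounded_indep_def one_bounded_def norm_mult intro!: mult_le_one)
    then show ?case
      by (simp add: prod.distrib)
  next
    case (average_nat A R)
    then show ?case
      by (auto simp: average_mult_left [symmetric] intro: structured.average_nat)
  qed
next
  case (average_nat A Q)
  then show ?case
    by (auto simp: average_mult_right [symmetric] intro: structured.average_nat)
qed

lemma structured_prod:
  assumes "finite X" "\<And>\<xi>. \<xi> \<in> X \<Longrightarrow> structured s (Q \<xi>)"
  shows "structured s (\<lambda>h. \<Prod>\<xi>\<in>X. Q \<xi> h)"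
  using assms by (induction X) (auto intro: structured_one structured_mult)

lemma structured_cnj:
  assumes "structured s Q"
  shows "structured s (\<lambda>h. cnj (Q h))"
  using assms
proof induction
  case (product B)
  have "structured s (\<lambda>h. \<Prod>t\<in>{1..s}. cnj (B t h))"
    using product by (intro structured.product) (auto simp: bounded_indep_def one_bounded_def)
  then show ?case
    by simp
next
  case (average_nat A Q)
  then show ?case
    by (auto simp: cnj_average intro: structured.average_nat)
qed

text \<open>A coordinatewise substitution turns an update at \<open>t\<close> into an update at the
  same \<open>t\<close>, so independence of \<open>t\<close> survives.\<close>

lemma structured_reparametrize:
  assumes "structured s Q"
  shows "structured s (\<lambda>h. Q (\<lambda>t. a t (h t)))"
  using assms
proof induction
  case (product B)
  have "(\<lambda>t'. a t' ((h(t := z)) t')) = (\<lambda>t'. a t' (h t'))(t := a t z)" for h t z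
    by auto
  then show ?case
    using product by (intro structured.product) (auto simp: bounded_indep_def one_bounded_def)
next
  case (average_nat A Q)
  then show ?case
    by (auto intro: structured.average_nat)
qed

text \<open>The correlation is linear in \<open>Q\<close>, so by Jensen the box inequality for
  products passes to their averages without loss.\<close>

lemma structured_correlation:
  fixes f :: "'a::{field,finite} ^ 'n \<Rightarrow> complex"
  assumes "structured (Suc s) Q"
  shows "cmod (average ({1..Suc s} \<rightarrow>\<^sub>E UNIV) (\<lambda>h. f (\<Sum>t\<in>{1..Suc s}. h t) * Q h)) ^ 2 ^ Suc s
    \<le> Re (gowers_average (Suc s) f)"
  using assms
proof induction
  case (product B)
  then show ?case
    using box_cauchy_schwarz [of s B f 0] by simp
next
  case (average_nat A Q)
  have "average ({1..Suc s} \<rightarrow>\<^sub>E UNIV) (\<lambda>h. f (\<Sum>t\<in>{1..Suc s}. h t) * average A (\<lambda>i. Q i h)) =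
    average A (\<lambda>i. average ({1..Suc s} \<rightarrow>\<^sub>E UNIV) (\<lambda>h. f (\<Sum>t\<in>{1..Suc s}. h t) * Q i h))"
    unfolding average_mult_left [symmetric] by (rule average_swap)
  moreover have "cmod (average A (\<lambda>i. average ({1..Suc s} \<rightarrow>\<^sub>E UNIV)
      (\<lambda>h. f (\<Sum>t\<in>{1..Suc s}. h t) * Q i h))) ^ 2 ^ Suc s
    \<le> Re (average A (\<lambda>i. gowers_average (Suc s) f))"
    using average_nat by (intro cmod_average_power_le) auto
  ultimately show ?case
    using average_nat by simp
qed

text \<open>Pulling back along the sum of \<open>s\<close> coordinates puts \<open>F\<close> into
  the setting of the box inequality. The name reflects \<open>antiuniform_correlation\<close>: the
  Gowers norm controls the correlation with such functions.\<close>

definition antiuniform :: "nat \<Rightarrow> ('v::comm_monoid_add \<Rightarrow> complex) \<Rightarrow> bool" where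
  "antiuniform s F \<longleftrightarrow> structured s (\<lambda>h. F (\<Sum>t\<in>{1..s}. h t))"

text \<open>With the other coordinates fixed, the last one translates the sum over the whole group,
  so the sum is equidistributed.\<close>

lemma average_sum_coords:
  fixes g :: "'v::{ab_group_add,finite} \<Rightarrow> complex"
  shows "average ({1..Suc s} \<rightarrow>\<^sub>E UNIV) (\<lambda>h. g (\<Sum>t\<in>{1..Suc s}. h t)) = average UNIV g"
proof -
  have ins: "{1..Suc s} = insert (Suc s) {1..s}"
    by auto
  have sum: "(\<Sum>t\<in>{1..Suc s}. (h(Suc s := z)) t) = (\<Sum>t\<in>{1..s}. h t) + z" for h :: "nat \<Rightarrow> 'v" and z
  proof -
    have "(\<Sum>t\<in>{1..s}. (h(Suc s := z)) t) = (\<Sum>t\<in>{1..s}. h t)"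
      by (intro sum.cong) auto
    then show ?thesis
      by (simp add: ins add.commute)
  qed
  have "average ({1..Suc s} \<rightarrow>\<^sub>E UNIV) (\<lambda>h. g (\<Sum>t\<in>{1..Suc s}. h t)) =
    average ({1..s} \<rightarrow>\<^sub>E UNIV) (\<lambda>h. average UNIV (\<lambda>z. g ((\<Sum>t\<in>{1..s}. h t) + z)))"
    using average_PiE_insert [of "{1..s}" "Suc s" "\<lambda>h. g (\<Sum>t\<in>{1..Suc s}. h t)"]
    unfolding ins [symmetric] sum by simp
  also have "\<dots> = average UNIV g"
    unfolding average_translate_left
    by (rule average_const) (auto simp: PiE_eq_empty_iff intro: finite_PiE)
  finally show ?thesis .
qed

lemma antiuniform_correlation:
  fixes f :: "'a::{field,finite} ^ 'n \<Rightarrow> complex"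
  assumes "antiuniform (Suc s) F"
  shows "cmod (average UNIV (\<lambda>y. f y * F y)) ^ 2 ^ Suc s \<le> Re (gowers_average (Suc s) f)"
  using structured_correlation [OF assms [unfolded antiuniform_def], of f]
  by (simp only: average_sum_coords [where g = "\<lambda>y. f y * F y"])

section \<open>Linear forms\<close>

definition pairing :: "'a::field ^ 'd \<Rightarrow> 'a ^ 'd \<Rightarrow> 'a" where
  "pairing \<xi> v = (\<Sum>m\<in>UNIV. \<xi> $ m * v $ m)"

text \<open>The elementary tensor of \<open>v\<close> and \<open>y\<close>.\<close>

definition direction :: "'a::field ^ 'd \<Rightarrow> 'a ^ 'n \<Rightarrow> ('a ^ 'n) ^ 'd" where
  "direction v y = (\<chi> m. (v $ m) *s y)"

lemma form_apply_add: "form_apply \<xi> (x + y) = form_apply \<xi> x + form_apply \<xi> y"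
  by (simp add: form_apply_def vec.scale_right_distrib sum.distrib)

lemma form_apply_diff: "form_apply \<xi> (x - y) = form_apply \<xi> x - form_apply \<xi> y"
  by (simp add: form_apply_def vec.scale_right_diff_distrib sum_subtractf)

lemma form_apply_sum: "form_apply \<xi> (\<Sum>t\<in>A. x t) = (\<Sum>t\<in>A. form_apply \<xi> (x t))"
  by (induction A rule: infinite_finite_induct)
    (simp_all add: form_apply_add, simp_all add: form_apply_def)

lemma form_apply_direction: "form_apply \<xi> (direction v y) = pairing \<xi> v *s y"
  by (simp add: form_apply_def direction_def pairing_def vec.scale_sum_left)

lemma direction_diff: "direction v (y - z) = direction v y - direction v z"
  by (simp add: direction_def vec_eq_iff right_diff_distrib)

text \<open>A basis of the span of \<open>C\<close> stays independent after \<open>\<phi>\<close> is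
  added, so some linear functional is 1 at \<open>\<phi>\<close> and vanishes on \<open>C\<close>;
  in coordinates it is the pairing with a vector.\<close>

lemma separating_vector:
  fixes \<phi> :: "'a::field ^ 'd"
  assumes "\<phi> \<notin> vec.span C"
  obtains v where "pairing \<phi> v = 1" "\<And>\<xi>. \<xi> \<in> C \<Longrightarrow> pairing \<xi> v = 0"
proof -
  interpret scalars: vector_space "(*) :: 'a \<Rightarrow> 'a \<Rightarrow> 'a"
    by unfold_locales (simp_all add: algebra_simps)
  interpret functionals: vector_space_pair "(*s) :: 'a \<Rightarrow> 'a ^ 'd \<Rightarrow> 'a ^ 'd" "(*) :: 'a \<Rightarrow> 'a \<Rightarrow> 'a"
    by unfold_locales
  obtain B where B: "B \<subseteq> C" "vec.independent B" "C \<subseteq> vec.span B"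
    using vec.maximal_independent_subset [of C] by blast
  have "vec.span B = vec.span C"
    using B by (metis vec.span_mono vec.span_span subset_antisym)
  then have "vec.independent (insert \<phi> B)"
    using assms B by (auto simp: vec.independent_insert)
  from functionals.linear_independent_extend [OF this, of "\<lambda>x. if x = \<phi> then 1 else 0"]
  obtain g where g: "Vector_Spaces.linear (*s) (*) g"
    and gB: "\<And>x. x \<in> insert \<phi> B \<Longrightarrow> g x = (if x = \<phi> then 1 else 0)"
    by blast
  interpret g: Vector_Spaces.linear "(*s)" "(*)" g
    by (rule g)
  \<comment> \<open>The representing vector lists the values of the functional at the unit
    vectors.\<close>
  define v :: "'a ^ 'd" where "v = (\<chi> m. g (axis m 1))"
  have pairing: "pairing \<xi> v = g \<xi>" for \<xi>
  proof -
    have "g \<xi> = g (\<Sum>m\<in>UNIV. (\<xi> $ m) *s axis m 1)"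
      by (simp add: basis_expansion)
    also have "\<dots> = pairing \<xi> v"
      by (simp add: g.sum g.scale pairing_def v_def)
    finally show ?thesis ..
  qed
  have "\<phi> \<notin> B"
    using assms B(1) vec.span_base by blast
  then have "g \<xi> = 0" if "\<xi> \<in> B" for \<xi>
    using gB that by auto
  then have "g \<xi> = 0" if "\<xi> \<in> vec.span B" for \<xi>
    using that by (rule functionals.linear_eq_0_on_span [OF g])
  with B(3) gB [of \<phi>] show ?thesis
    by (intro that [of v]) (auto simp: pairing)
qed

text \<open>Functions are attached to forms instead of indices, so that replacing the function at a
  form is a function update.\<close>

definition form_avg :: "('a::{field,finite} ^ 'd) set \<Rightarrow> ('a ^ 'd \<Rightarrow> 'a ^ 'n \<Rightarrow> complex) \<Rightarrow> complex" where
  "form_avg X F = average UNIV (\<lambda>x. \<Prod>\<xi>\<in>X. F \<xi> (form_apply \<xi> x))"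

text \<open>
  For \<open>pairing \<phi> v = 1\<close>, the point \<open>x + direction v (y - form_apply \<phi> x)\<close> runs uniformly through
  the fibre of \<open>\<phi>\<close> over \<open>y\<close>; in particular the value does not depend on the choice of \<open>v\<close>.
\<close>
definition dual_function ::
  "('a::{field,finite} ^ 'd) set \<Rightarrow> ('a ^ 'd \<Rightarrow> 'a ^ 'n \<Rightarrow> complex) \<Rightarrow> 'a ^ 'd \<Rightarrow> 'a ^ 'd \<Rightarrow> 'a ^ 'n \<Rightarrow> complex"
  where "dual_function X F \<phi> v y =
    average UNIV (\<lambda>x. \<Prod>\<xi>\<in>X - {\<phi>}. F \<xi> (form_apply \<xi> (x + direction v (y - form_apply \<phi> x))))"

text \<open>Substitute \<open>y = z + form_apply \<phi> x\<close>. The argument of \<open>G\<close>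
  becomes \<open>x + direction v z\<close>, at which \<open>\<phi>\<close> takes the value
  \<open>y\<close> since \<open>pairing \<phi> v = 1\<close>; then translate \<open>x\<close> for
  each fixed \<open>z\<close>.\<close>

lemma average_fibres:
  fixes G :: "('a::{field,finite} ^ 'n) ^ 'd \<Rightarrow> complex"
  assumes "pairing \<phi> v = 1"
  shows "average UNIV (\<lambda>y. g y * average UNIV (\<lambda>x. G (x + direction v (y - form_apply \<phi> x)))) =
    average UNIV (\<lambda>x. g (form_apply \<phi> x) * G x)"
proof -
  let ?H = "\<lambda>x. g (form_apply \<phi> x) * G x"
  have shift: "average UNIV (\<lambda>y. g y * G (x + direction v (y - form_apply \<phi> x))) =
      average UNIV (\<lambda>z. ?H (x + direction v z))" for x
    using average_translate [of "\<lambda>y. g y * G (x + direction v (y - form_apply \<phi> x))" "form_apply \<phi> x"]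
    by (simp add: form_apply_add form_apply_direction assms add.commute)
  have "average UNIV (\<lambda>y. g y * average UNIV (\<lambda>x. G (x + direction v (y - form_apply \<phi> x)))) =
      average UNIV (\<lambda>x. average UNIV (\<lambda>y. g y * G (x + direction v (y - form_apply \<phi> x))))"
    unfolding average_mult_left [symmetric] by (rule average_swap)
  also have "\<dots> = average UNIV (\<lambda>z :: 'a ^ 'n. average UNIV (\<lambda>x. ?H (x + direction v z)))"
    unfolding shift by (rule average_swap)
  also have "\<dots> = average UNIV ?H"
    by (simp only: average_translate [of ?H]) simp
  finally show ?thesis .
qed

text \<open>The dual function omits the factor at \<open>\<phi>\<close>, so one identity serves both
  the original function there and its replacement.\<close>

lemma form_avg_dual_function:
  assumes "finite X" "\<phi> \<in> X" "pairing \<phi> v = 1"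
  shows "form_avg X (F(\<phi> := g)) = average UNIV (\<lambda>y. g y * dual_function X F \<phi> v y)"
proof -
  have "(\<Prod>\<xi>\<in>X. (F(\<phi> := g)) \<xi> (form_apply \<xi> x)) =
      g (form_apply \<phi> x) * (\<Prod>\<xi>\<in>X - {\<phi>}. F \<xi> (form_apply \<xi> x))" for x
    using assms(1,2) by (subst prod.remove [of X \<phi>]) auto
  then show ?thesis
    unfolding form_avg_def dual_function_def
    by (simp only: average_fibres [OF assms(3), of g "\<lambda>x. \<Prod>\<xi>\<in>X - {\<phi>}. F \<xi> (form_apply \<xi> x)"])
qed

lemma one_bounded_dual_function:
  assumes "\<And>\<xi>. \<xi> \<in> X \<Longrightarrow> one_bounded (F \<xi>)"
  shows "one_bounded (dual_function X F \<phi> v)"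
  unfolding one_bounded_def dual_function_def
  using assms
  by (intro allI cmod_average_le)
    (auto simp: one_bounded_def prod_norm [symmetric] intro!: prod_le_1)

text \<open>Cauchy--Schwarz yields the mean square of the dual function, which is again a form
  average, with the conjugate of the dual function placed at \<open>\<phi>\<close>.\<close>

lemma form_avg_cauchy_schwarz:
  assumes "finite X" "\<phi> \<in> X" "pairing \<phi> v = 1" "one_bounded (F \<phi>)"
  shows "cmod (form_avg X F) ^ 2 \<le>
    cmod (form_avg X (F(\<phi> := \<lambda>y. cnj (dual_function X F \<phi> v y))))"
proof -
  have "cmod (form_avg X F) ^ 2 = cmod (average UNIV (\<lambda>y. F \<phi> y * dual_function X F \<phi> v y)) ^ 2"
    using form_avg_dual_function [OF assms(1-3), of F "F \<phi>"] by simp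
  also have "\<dots> \<le> Re (average UNIV (\<lambda>y. cnj (dual_function X F \<phi> v y) * dual_function X F \<phi> v y))"
    using assms(4) by (intro average_cauchy_schwarz) (auto simp: one_bounded_def)
  also have "\<dots> \<le> cmod (form_avg X (F(\<phi> := \<lambda>y. cnj (dual_function X F \<phi> v y))))"
    unfolding form_avg_dual_function [OF assms(1-3)] by (rule complex_Re_le_cmod)
  finally show ?thesis .
qed

lemma antiuniform_affine:
  fixes F :: "'a::field ^ 'n \<Rightarrow> complex"
  assumes "antiuniform s F" "s \<ge> 1"
  shows "structured s (\<lambda>h. F (z + (\<Sum>t\<in>{1..s}. c t *s h t)))"
proof -
  \<comment> \<open>The translation \<open>z\<close> is loaded onto the first coordinate, which
    exists because \<open>s \<ge> 1\<close>.\<close>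
  have "structured s (\<lambda>h. F (\<Sum>t\<in>{1..s}. (if t = 1 then z else 0) + c t *s h t))"
    using structured_reparametrize [OF assms(1) [unfolded antiuniform_def],
        of "\<lambda>t y. (if t = 1 then z else 0) + c t *s y"] .
  then show ?thesis
    using assms(2) by (simp add: sum.distrib)
qed

text \<open>
  Translating the average defining the dual function along the fibre turns the \<open>t\<close>-th coordinate
  into a motion in the direction \<open>u t\<close>, which a factor \<open>F \<xi>\<close> with \<open>pairing \<xi> (u t) = 0\<close> does not
  see.
\<close>
lemma antiuniform_dual_function:
  fixes F :: "'a::{field,finite} ^ 'd \<Rightarrow> 'a ^ 'n \<Rightarrow> complex"
  assumes "finite X" "s \<ge> 1"
    and bdd: "\<And>\<xi>. \<xi> \<in> X \<Longrightarrow> one_bounded (F \<xi>)"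
    and v: "pairing \<phi> v = 1"
    and u: "\<And>t. t \<in> {1..s} \<Longrightarrow> pairing \<phi> (u t) = 1"
    and cover: "\<And>\<xi>. \<xi> \<in> X - {\<phi>} \<Longrightarrow> antiuniform s (F \<xi>) \<or> (\<exists>t\<in>{1..s}. pairing \<xi> (u t) = 0)"
  shows "antiuniform s (dual_function X F \<phi> v)"
proof -
  \<comment> \<open>The projection of \<open>x\<close> to the kernel of \<open>\<phi>\<close> along
    \<open>v\<close>.\<close>
  define z where "z x = x - direction v (form_apply \<phi> x)" for x :: "('a ^ 'n) ^ 'd"
  define Q where "Q \<xi> x h = F \<xi> (form_apply \<xi> (z x) + (\<Sum>t\<in>{1..s}. pairing \<xi> (u t) *s h t))"
    for \<xi> x and h :: "nat \<Rightarrow> 'a ^ 'n"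
  have Q: "structured s (Q \<xi> x)" if "\<xi> \<in> X - {\<phi>}" for \<xi> x
    using cover [OF that]
  proof
    assume "antiuniform s (F \<xi>)"
    then show ?thesis
      unfolding Q_def using \<open>s \<ge> 1\<close> by (rule antiuniform_affine)
  next
    assume "\<exists>t\<in>{1..s}. pairing \<xi> (u t) = 0"
    then obtain t where t: "t \<in> {1..s}" "pairing \<xi> (u t) = 0"
      by blast
    have "(\<Sum>t'\<in>{1..s}. pairing \<xi> (u t') *s (h(t := y)) t') = (\<Sum>t'\<in>{1..s}. pairing \<xi> (u t') *s h t')"
      for h :: "nat \<Rightarrow> 'a ^ 'n" and y
      using t by (intro sum.cong) auto
    then have "bounded_indep t (Q \<xi> x)"
      using bdd that by (simp add: bounded_indep_def one_bounded_def Q_def)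
    with t(1) show ?thesis
      by (rule structured_indep)
  qed
  have "dual_function X F \<phi> v (\<Sum>t\<in>{1..s}. h t) = average UNIV (\<lambda>x. \<Prod>\<xi>\<in>X - {\<phi>}. Q \<xi> x h)"
    for h :: "nat \<Rightarrow> 'a ^ 'n"
  proof -
    let ?y = "\<Sum>t\<in>{1..s}. h t"
    \<comment> \<open>Moving each \<open>h t\<close> along \<open>u t\<close> and moving their sum
      along \<open>v\<close> both raise \<open>\<phi>\<close> by \<open>?y\<close>. The difference
      \<open>a\<close> thus lies in the kernel of \<open>\<phi>\<close>, and translating
      \<open>x\<close> by it exchanges one motion for the other.\<close>
    define a where "a = (\<Sum>t\<in>{1..s}. direction (u t) (h t)) - direction v ?y"
    have "(\<Sum>t\<in>{1..s}. pairing \<phi> (u t) *s h t) = ?y"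
      using u by (intro sum.cong) auto
    then have a: "form_apply \<phi> a = 0"
      by (simp add: a_def form_apply_diff form_apply_sum form_apply_direction v)
    have point: "(x + a) + direction v (?y - form_apply \<phi> (x + a)) =
        z x + (\<Sum>t\<in>{1..s}. direction (u t) (h t))" for x
      by (simp add: form_apply_add a direction_diff z_def) (simp add: a_def)
    have "dual_function X F \<phi> v ?y = average UNIV (\<lambda>x. \<Prod>\<xi>\<in>X - {\<phi>}.
        F \<xi> (form_apply \<xi> ((x + a) + direction v (?y - form_apply \<phi> (x + a)))))"
      unfolding dual_function_def
      by (rule average_translate [symmetric, where g = "\<lambda>x. \<Prod>\<xi>\<in>X - {\<phi>}.
        F \<xi> (form_apply \<xi> (x + direction v (?y - form_apply \<phi> x)))"])
    then show ?thesis
      unfolding point by (simp add: Q_def form_apply_add form_apply_sum form_apply_direction)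
  qed
  moreover have "structured s (\<lambda>h. average UNIV (\<lambda>x. \<Prod>\<xi>\<in>X - {\<phi>}. Q \<xi> x h))"
    using assms(1) Q by (intro structured_average structured_prod) auto
  ultimately show ?thesis
    by (simp add: antiuniform_def)
qed

section \<open>Iterated Cauchy--Schwarz along the sequence\<close>

locale cs_sequence =
  fixes X :: "('a::{field,finite} ^ 'd) set" and \<sigma> :: "nat \<Rightarrow> 'a ^ 'd" and s l :: nat
  assumes mem: "\<And>j. j \<in> {1..l} \<Longrightarrow> \<sigma> j \<in> X"
    and s_pos: "s \<ge> 1"
    and cover: "\<And>j. j \<in> {1..l} \<Longrightarrow> \<exists>C. X - \<sigma> ` {1..j} \<subseteq> (\<Union>t\<in>{1..s}. C t) \<and>
      (\<forall>t\<in>{1..s}. \<sigma> j \<notin> vec.span (C t))"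
begin

lemma antiuniform_dual_step:
  fixes F :: "'a ^ 'd \<Rightarrow> 'a ^ 'n \<Rightarrow> complex"
  assumes j: "Suc j \<le> l"
    and bdd: "\<And>\<xi>. \<xi> \<in> X \<Longrightarrow> one_bounded (F \<xi>)"
    and anti: "\<And>\<xi>. \<xi> \<in> \<sigma> ` {1..j} \<Longrightarrow> antiuniform s (F \<xi>)"
  obtains v where "pairing (\<sigma> (Suc j)) v = 1"
    and "antiuniform s (dual_function X F (\<sigma> (Suc j)) v)"
proof -
  from j cover [of "Suc j"] obtain C where
    C: "X - \<sigma> ` {1..Suc j} \<subseteq> (\<Union>t\<in>{1..s}. C t)" and
    span: "\<And>t. t \<in> {1..s} \<Longrightarrow> \<sigma> (Suc j) \<notin> vec.span (C t)"
    by auto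
  have "\<exists>v. pairing (\<sigma> (Suc j)) v = 1 \<and> (\<forall>\<xi>\<in>C t. pairing \<xi> v = 0)" if "t \<in> {1..s}" for t
    by (rule separating_vector [OF span [OF that]]) blast
  then obtain u where
    u: "\<And>t. t \<in> {1..s} \<Longrightarrow> pairing (\<sigma> (Suc j)) (u t) = 1" and
    uC: "\<And>t \<xi>. t \<in> {1..s} \<Longrightarrow> \<xi> \<in> C t \<Longrightarrow> pairing \<xi> (u t) = 0"
    by metis
  have split: "\<sigma> ` {1..Suc j} = insert (\<sigma> (Suc j)) (\<sigma> ` {1..j})"
    by (simp add: atLeastAtMostSuc_conv)
  have "antiuniform s (F \<xi>) \<or> (\<exists>t\<in>{1..s}. pairing \<xi> (u t) = 0)" if "\<xi> \<in> X - {\<sigma> (Suc j)}" for \<xi>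
  proof (cases "\<xi> \<in> \<sigma> ` {1..j}")
    case False
    with that C split obtain t where "t \<in> {1..s}" "\<xi> \<in> C t"
      by blast
    with uC show ?thesis
      by blast
  qed (use anti in blast)
  \<comment> \<open>The fibres may be parametrized by any vector that pairs to 1 with the form;
    \<open>u 1\<close> is at hand because \<open>s \<ge> 1\<close>.\<close>
  moreover have "pairing (\<sigma> (Suc j)) (u 1) = 1"
    using u s_pos by simp
  ultimately show ?thesis
    using s_pos bdd u by (intro that [of "u 1"] antiuniform_dual_function) auto
qed

lemma iterated_cauchy_schwarz:
  fixes F :: "'a ^ 'd \<Rightarrow> 'a ^ 'n \<Rightarrow> complex"
  assumes "j \<le> l" and bdd: "\<And>\<xi>. \<xi> \<in> X \<Longrightarrow> one_bounded (F \<xi>)"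
  obtains F' where "\<And>\<xi>. \<xi> \<in> X \<Longrightarrow> one_bounded (F' \<xi>)"
    and "\<And>\<xi>. \<xi> \<notin> \<sigma> ` {1..j} \<Longrightarrow> F' \<xi> = F \<xi>"
    and "\<And>\<xi>. \<xi> \<in> \<sigma> ` {1..j} \<Longrightarrow> antiuniform s (F' \<xi>)"
    and "cmod (form_avg X F) ^ 2 ^ j \<le> cmod (form_avg X F')"
  using assms(1)
proof (induction j arbitrary: thesis)
  case 0
  show ?case
    using bdd by (intro "0.prems"(1) [of F]) auto
next
  case (Suc j)
  let ?\<phi> = "\<sigma> (Suc j)"
  obtain F' where F': "\<And>\<xi>. \<xi> \<in> X \<Longrightarrow> one_bounded (F' \<xi>)"
    "\<And>\<xi>. \<xi> \<notin> \<sigma> ` {1..j} \<Longrightarrow> F' \<xi> = F \<xi>"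
    "\<And>\<xi>. \<xi> \<in> \<sigma> ` {1..j} \<Longrightarrow> antiuniform s (F' \<xi>)"
    "cmod (form_avg X F) ^ 2 ^ j \<le> cmod (form_avg X F')"
    using Suc.IH Suc.prems(2) by (metis Suc_leD)
  obtain v where v: "pairing ?\<phi> v = 1" "antiuniform s (dual_function X F' ?\<phi> v)"
    using antiuniform_dual_step [where F = F', OF Suc.prems(2) F'(1,3)] by blast
  define F'' where "F'' = F'(?\<phi> := \<lambda>y. cnj (dual_function X F' ?\<phi> v y))"
  have \<phi>: "?\<phi> \<in> X"
    using mem Suc.prems(2) by simp
  have split: "\<sigma> ` {1..Suc j} = insert ?\<phi> (\<sigma> ` {1..j})"
    by (simp add: atLeastAtMostSuc_conv)
  show ?case
  proof (rule Suc.prems(1) [of F''])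
    show "one_bounded (F'' \<xi>)" if "\<xi> \<in> X" for \<xi>
      using F'(1) that one_bounded_dual_function [of X F' ?\<phi> v]
      by (simp add: F''_def one_bounded_def)
    show "F'' \<xi> = F \<xi>" if "\<xi> \<notin> \<sigma> ` {1..Suc j}" for \<xi>
      using that F'(2) unfolding split by (simp add: F''_def)
    show "antiuniform s (F'' \<xi>)" if "\<xi> \<in> \<sigma> ` {1..Suc j}" for \<xi>
      using that F'(3) structured_cnj [OF v(2) [unfolded antiuniform_def]]
      unfolding split by (auto simp: F''_def antiuniform_def)
    have "cmod (form_avg X F) ^ 2 ^ Suc j = (cmod (form_avg X F) ^ 2 ^ j) ^ 2"
      by (simp add: mult.commute flip: power_mult)
    also have "\<dots> \<le> cmod (form_avg X F') ^ 2"
      using F'(4) by (intro power_mono) auto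
    also have "\<dots> \<le> cmod (form_avg X F'')"
      unfolding F''_def using \<phi> F'(1) v(1) by (intro form_avg_cauchy_schwarz) auto
    finally show "cmod (form_avg X F) ^ 2 ^ Suc j \<le> cmod (form_avg X F'')" .
  qed
qed

text \<open>After \<open>j\<close> replacements the form \<open>\<sigma> (Suc j)\<close>, not
  visited before, still carries its original function. The average is the correlation of that
  function with an antiuniform dual function, so no further squaring beyond the \<open>j\<close> is
  spent before the Gowers norm enters.\<close>

lemma form_avg_le_gowers_average:
  fixes F :: "'a ^ 'd \<Rightarrow> 'a ^ 'n \<Rightarrow> complex"
  assumes "Suc j \<le> l" "\<sigma> (Suc j) \<notin> \<sigma> ` {1..j}"
    and bdd: "\<And>\<xi>. \<xi> \<in> X \<Longrightarrow> one_bounded (F \<xi>)"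
  shows "(cmod (form_avg X F) ^ 2 ^ j) ^ 2 ^ s \<le> Re (gowers_average s (F (\<sigma> (Suc j))))"
proof -
  let ?\<phi> = "\<sigma> (Suc j)"
  obtain F' where F': "\<And>\<xi>. \<xi> \<in> X \<Longrightarrow> one_bounded (F' \<xi>)"
    "\<And>\<xi>. \<xi> \<notin> \<sigma> ` {1..j} \<Longrightarrow> F' \<xi> = F \<xi>"
    "\<And>\<xi>. \<xi> \<in> \<sigma> ` {1..j} \<Longrightarrow> antiuniform s (F' \<xi>)"
    "cmod (form_avg X F) ^ 2 ^ j \<le> cmod (form_avg X F')"
    using iterated_cauchy_schwarz [where F = F, OF Suc_leD [OF assms(1)] bdd] by blast
  obtain v where v: "pairing ?\<phi> v = 1" "antiuniform s (dual_function X F' ?\<phi> v)"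
    using antiuniform_dual_step [where F = F', OF assms(1) F'(1,3)] by blast
  have "?\<phi> \<in> X"
    using mem assms(1) by simp
  then have "form_avg X F' = average UNIV (\<lambda>y. F ?\<phi> y * dual_function X F' ?\<phi> v y)"
    using form_avg_dual_function [of X ?\<phi> v F' "F' ?\<phi>"] v(1) F'(2) [OF assms(2)]
    unfolding fun_upd_triv by simp
  moreover have "cmod (average UNIV (\<lambda>y. F ?\<phi> y * dual_function X F' ?\<phi> v y)) ^ 2 ^ s
      \<le> Re (gowers_average s (F ?\<phi>))"
    using antiuniform_correlation [of "s - 1"] v(2) s_pos by simp
  ultimately have "cmod (form_avg X F') ^ 2 ^ s \<le> Re (gowers_average s (F ?\<phi>))"
    by (simp only:)
  moreover have "(cmod (form_avg X F) ^ 2 ^ j) ^ 2 ^ s \<le> cmod (form_avg X F') ^ 2 ^ s"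
    using F'(4) by (intro power_mono) auto
  ultimately show ?thesis
    by (rule order_trans [rotated])
qed

end

section \<open>Choice of the stopping index and extraction of roots\<close>

theorem theorem1p8:
  fixes k l r i :: nat
    and \<psi> :: "nat \<Rightarrow> 'p::prime_card mod_ring ^ 'd"
    and f :: "nat \<Rightarrow> 'p mod_ring ^ 'n \<Rightarrow> complex"
  assumes "k \<ge> 1" and "l \<ge> 1" and "r \<ge> 1"
    and "inj_on \<psi> {1..r}"
    and "i \<in> {1..r}"
    and "seq_CS_complexity_at_most (\<psi> ` {1..r}) (\<psi> i) k l"
    and "\<And>j. j \<in> {1..r} \<Longrightarrow> one_bounded (f j)"
  shows "cmod (form_average r \<psi> f) \<le> gowers_norm (k + 1) (f i) powr (2 powr (1 - real l))"
proof -
  let ?X = "\<psi> ` {1..r}"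
  \<comment> \<open>Injectivity of \<open>\<psi>\<close> lets the functions be indexed by the
    forms.\<close>
  define F where "F \<xi> = f (inv_into {1..r} \<psi> \<xi>)" for \<xi>
  have F: "F (\<psi> j) = f j" if "j \<in> {1..r}" for j
    using assms(4) that by (simp add: F_def)
  have bdd: "one_bounded (F \<xi>)" if "\<xi> \<in> ?X" for \<xi>
    using that F assms(7) by auto
  have avg: "form_average r \<psi> f = form_avg ?X F"
    unfolding form_average_def form_avg_def prod.reindex [OF assms(4)]
    using F by (intro average_cong prod.cong) auto
  from assms(6) [unfolded seq_CS_complexity_at_most_def] obtain \<sigma> where \<sigma>: "\<sigma> ` {1..l} \<subseteq> ?X" "\<sigma> l = \<psi> i"
    and cover: "\<forall>j\<in>{1..l}. \<exists>C :: nat \<Rightarrow> ('p mod_ring ^ 'd) set.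
      (\<forall>t\<in>{1..k+1}. C t \<subseteq> ?X) \<and> ?X - \<sigma> ` {1..j} \<subseteq> (\<Union>t\<in>{1..k+1}. C t) \<and>
      (\<forall>t\<in>{1..k+1}. \<sigma> ` {1..j} \<inter> vec.span (C t) = {})"
    by (elim exE conjE) (rule that)
  interpret cs_sequence ?X \<sigma> "k + 1" l
  proof
    show "\<exists>C. ?X - \<sigma> ` {1..j} \<subseteq> (\<Union>t\<in>{1..k+1}. C t) \<and> (\<forall>t\<in>{1..k+1}. \<sigma> j \<notin> vec.span (C t))"
      if j: "j \<in> {1..l}" for j
    proof -
      have "\<sigma> j \<in> \<sigma> ` {1..j}"
        using j by simp
      moreover from bspec [OF cover j] obtain C :: "nat \<Rightarrow> ('p mod_ring ^ 'd) set" where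
        "?X - \<sigma> ` {1..j} \<subseteq> (\<Union>t\<in>{1..k+1}. C t)"
        "\<forall>t\<in>{1..k+1}. \<sigma> ` {1..j} \<inter> vec.span (C t) = {}"
        by (elim exE conjE) (rule that)
      ultimately show ?thesis
        by (intro exI [of _ C]) blast
    qed
    show "\<sigma> j \<in> ?X" if "j \<in> {1..l}" for j
      using \<sigma>(1) that by blast
  qed simp
  \<comment> \<open>The sequence may visit \<open>\<psi> i\<close> several times; the argument has to stop at the first visit,
    before \<open>f i\<close> is replaced.\<close>
  define m where "m = (LEAST m. \<sigma> (Suc m) = \<psi> i)"
  have last: "\<sigma> (Suc (l - 1)) = \<psi> i"
    using \<sigma>(2) assms(2) by simp
  then have m: "\<sigma> (Suc m) = \<psi> i" and "m \<le> l - 1"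
    unfolding m_def by (rule LeastI, rule Least_le)
  then have ml: "Suc m \<le> l"
    using assms(2) by simp
  have "\<sigma> (Suc m) \<notin> \<sigma> ` {1..m}"
  proof
    assume "\<sigma> (Suc m) \<in> \<sigma> ` {1..m}"
    then obtain j where "j \<in> {1..m}" "\<sigma> j = \<psi> i"
      using m by auto
    then have "j - 1 < m" "\<sigma> (Suc (j - 1)) = \<psi> i"
      by auto
    then show False
      unfolding m_def using not_less_Least by blast
  qed
  from form_avg_le_gowers_average [where F = F, OF ml this bdd]
  have main: "(cmod (form_avg ?X F) ^ 2 ^ m) ^ 2 ^ (k + 1) \<le> Re (gowers_average (k + 1) (f i))"
    using F [OF assms(5)] m by simp
  define N where "N = gowers_norm (k + 1) (f i)"
  define c where "c = cmod (form_avg ?X F)"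
  have "c \<ge> 0"
    by (simp add: c_def)
  have "root (2 ^ (k + 1)) ((c ^ 2 ^ m) ^ 2 ^ (k + 1)) \<le> N"
    unfolding N_def gowers_norm_def c_def using main by (intro real_root_le_mono) simp_all
  then have le: "c ^ 2 ^ m \<le> N"
    using \<open>c \<ge> 0\<close> by (simp only: real_root_power_cancel zero_less_power zero_less_numeral zero_le_power)
  have "Re (gowers_average (k + 1) (f i)) \<le> 1"
    using cmod_gowers_average_le [OF assms(7) [OF assms(5)], of "k + 1"] complex_Re_le_cmod
    by (rule order_trans [rotated])
  then have "N \<le> 1"
    unfolding N_def gowers_norm_def by simp
  have "c \<le> N powr (2 powr (1 - real l))"
  proof (cases "c = 0")
    case False
    with \<open>c \<ge> 0\<close> have "c > 0"
      by simp
    with le have "N > 0"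
      by (meson less_le_trans zero_less_power)
    \<comment> \<open>Taking roots undoes the \<open>m\<close> squarings.\<close>
    have "c = (c ^ 2 ^ m) powr (2 powr - real m)"
      using \<open>c > 0\<close> by (simp add: powr_powr powr_minus flip: powr_realpow)
    also have "\<dots> \<le> N powr (2 powr - real m)"
      using le \<open>c > 0\<close> by (intro powr_mono2) auto
    \<comment> \<open>Stopping at the first visit gives \<open>m \<le> l - 1\<close>; since
      \<open>N \<le> 1\<close>, passing to the smaller exponent \<open>2 powr (1 - real l)\<close>
      only weakens the bound.\<close>
    also have "\<dots> \<le> N powr (2 powr (1 - real l))"
      using \<open>N > 0\<close> \<open>N \<le> 1\<close> ml by (intro powr_mono' powr_mono) auto
    finally show ?thesis .
  qed simp
  then show ?thesis
    by (simp add: avg c_def N_def)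
qed

end
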